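(* Let $\lambda_{d,k}$, $k\in\mathbb N$, be the coefficients of $\lambda(z)=\frac{\alpha(z)}{\beta(z)}(1-z^s)^{-d}=\sum_{k=0}^\infty\lambda_{d,k}z^k$, $|z|<1$, and let $f(z):=\frac{\alpha(z)}{\beta(z)}=\sum_{k=0}^\infty f_kz^k$. Then there is a function $\mathscr K(\cdot)$ on $\mathbb N$ such that, for each $r\in\{0,\dots,s-1\}$ and any $\nu>0$, $$\lambda_{d,sk+r}=\pi_{d,sk}\,\mathscr K(sk+r)+o(k^{-\nu}),\qquad k\to\infty,$$ where $\mathscr K(\cdot)$ satisfies $$\lim_{k\to\infty}\sum_{r=0}^{s-1}\mathscr K(sk+r)=\frac{\alpha(1)}{\beta(1)}.$$ Thus $$\sum_{r=0}^{s-1}\lambda_{d,sk+r}\sim\pi_{d,sk}\frac{\alpha(1)}{\beta(1)},\qquad k\to\infty.$$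
   Context: $\mathbb N=\{0,1,2,\dots\}$. Here $d\in\mathbb R$, $s\ge 1$ is an integer, and $\alpha(z)=\sum_{i=0}^p(-\alpha_i)z^i$ and $\beta(z)=\sum_{j=0}^q(-\beta_j)z^j$ are real polynomials of orders $p,q\ge 0$ with $\alpha_0=\beta_0=-1$, with no common roots, and with $\beta(z)\ne0$ for all $|z|\le1$. The numbers $\pi_{d,k}$ are the power series coefficients $(1-z^s)^{-d}=\sum_{k=0}^\infty\pi_{d,k}z^k$, i.e. $\pi_{d,k}=0$ if $s\nmid k$ and $\pi_{d,sk}=\frac{\Gamma(k+d)}{\Gamma(k+1)\Gamma(d)}$ (read as $d(d+1)\cdots(d+k-1)/k!$). The notation $a_k\sim b_k$ means $a_k/b_k\to1$, and $a_k=o(b_k)$ means $a_k/b_k\to 0$.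
   Formalization: The final asymptotic equivalence is stated only for d not in {0,-1,-2,...} and α(1) ≠ 0; otherwise its right side is eventually zero and the ratio is undefined (e.g. d=0, s=1, α=1, β=1-z/2). The first two assertions are stated for all d and α. *)

theory Defs
  imports "HOL-Analysis.Analysis" "HOL-Library.Landau_Symbols"
begin

definition lag_poly :: "(nat \<Rightarrow> real) \<Rightarrow> nat \<Rightarrow> 'a::{real_normed_field} \<Rightarrow> 'a" where
  "lag_poly c n z = (\<Sum>i\<le>n. of_real (- c i) * z ^ i)"

(* \<pi>_{d,k}. The quotient \<Gamma>(k+d) / (\<Gamma>(k+1) \<Gamma>(d)) is read as d (d+1) ... (d+k-1) / k!,
   which also makes sense when d is a nonpositive integer. *)
definition sfrac_coeff :: "real \<Rightarrow> nat \<Rightarrow> nat \<Rightarrow> real" where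
  "sfrac_coeff d s k =
     (if s dvd k then pochhammer d (k div s) / fact (k div s) else 0)"

lemma sfrac_coeff_sums:
  fixes z :: complex
  assumes "s \<ge> 1" "norm z < 1"
  shows "(\<lambda>k. of_real (sfrac_coeff d s k) * z ^ k) sums ((1 - z ^ s) powr of_real (- d))"
proof -
  have "norm (- (z ^ s)) < 1"
    using assms by (simp add: norm_power power_less_one_iff)
  from gen_binomial_complex[OF this, of "of_real (- d)"]
  have "(\<lambda>n. (of_real (- d) gchoose n) * (- (z ^ s)) ^ n) sums ((1 - z ^ s) powr of_real (- d))"
    by simp
  moreover have "(of_real (- d) gchoose n) * (- (z ^ s)) ^ n
      = of_real (sfrac_coeff d s (s * n)) * z ^ (s * n)" for n
  proof -
    have "(- (z ^ s)) ^ n = (-1) ^ n * z ^ (s * n)"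
      by (subst power_minus) (simp add: power_mult)
    then show ?thesis
      using assms(1)
      by (simp add: sfrac_coeff_def gbinomial_pochhammer flip: pochhammer_of_real)
  qed
  ultimately have "(\<lambda>n. of_real (sfrac_coeff d s (s * n)) * z ^ (s * n)) sums
      ((1 - z ^ s) powr of_real (- d))"
    by simp
  moreover have "strict_mono (\<lambda>n. s * n)"
    using assms(1) by (auto simp: strict_mono_def)
  moreover have "of_real (sfrac_coeff d s k) * z ^ k = 0" if "k \<notin> range (\<lambda>n. s * n)" for k
    using that by (auto simp: sfrac_coeff_def dvd_def)
  ultimately show ?thesis
    using sums_mono_reindex[of "\<lambda>n. s * n" "\<lambda>k. of_real (sfrac_coeff d s k) * z ^ k"] by blast
qed

end

theory Submission
  imports Defs "HOL-Complex_Analysis.Complex_Analysis" "HOL-Real_Asymp.Real_Asymp"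
begin

text \<open>
  Write \<open>g = \<alpha> / \<beta>\<close>. As \<open>\<beta>\<close> has finitely many zeros, all outside the closed unit disc,
  \<open>g\<close> is holomorphic on a disc of radius greater than 1. Its coefficients \<open>f\<^sub>k\<close> therefore
  decay geometrically, and they sum to \<open>g(1)\<close>.

  Only multiples of \<open>s\<close> carry a nonzero \<open>\<pi>\<close>, so multiplying the power series of \<open>g\<close> and of
  \<open>(1 - z\<^sup>s)\<^sup>-\<^sup>d\<close> gives, within each residue class \<open>r\<close> modulo \<open>s\<close>, an ordinary convolution
  of \<open>c\<^sub>k = \<pi>(sk)\<close> with \<open>k \<mapsto> f(sk+r)\<close> (\<open>lam_convolution\<close>).

  Suppose that \<open>d\<close> is not in \<open>{0, -1, -2, ...}\<close>. Then \<open>c\<^sub>k\<close> never vanishes and one may simply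
  take \<open>K(sk+r) = \<lambda>(sk+r) / c\<^sub>k\<close>, which leaves no error at all. What has to be shown
  is the limit of the sum over \<open>r\<close>, that is, of the convolution of \<open>c\<close> with the block sums
  \<open>F\<^sub>j = f(sj) + ... + f(sj+s-1)\<close>, divided by \<open>c\<^sub>k\<close>. Since \<open>c\<^sub>k\<^sub>+\<^sub>1 / c\<^sub>k\<close> tends to 1, each quotient
  \<open>c\<^sub>k\<^sub>-\<^sub>j / c\<^sub>k\<close> tends to 1 for fixed \<open>j\<close>, while in \<open>j\<close> it grows at most like \<open>\<mu>\<^sup>j\<close>, uniformly
  in \<open>k\<close>, for any chosen \<open>\<mu> > 1\<close> (\<open>earlier_terms_geometric_bound\<close>). The decay of \<open>F\<close> absorbs
  this growth, and dominated convergence for series gives the limit \<open>F\<^sub>0 + F\<^sub>1 + ... = g(1)\<close>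
  (\<open>convolution_quotient_tendsto\<close>). The asymptotic equivalence is the same limit divided by
  \<open>g(1)\<close>, which is assumed there to be nonzero.

  If \<open>d = -m\<close> with a natural number \<open>m\<close>, then \<open>(1 - z\<^sup>s)\<^sup>m\<close> is a polynomial, so
  \<open>\<lambda>(z)\<close> is itself holomorphic on the larger disc and its coefficients decay geometrically,
  whereas \<open>c\<^sub>k = 0\<close> for \<open>k > m\<close>. Any function \<open>K\<close> satisfies the expansion, and it remains
  to choose one with the required block sums.
\<close>

section \<open>Power series that extend beyond the unit disc\<close>

lemma has_fps_expansion_if_sums_unit_disc:
  fixes c :: "nat \<Rightarrow> complex"
  assumes sums: "\<And>z. norm z < 1 \<Longrightarrow> (\<lambda>k. c k * z ^ k) sums g z"
  shows "g has_fps_expansion Abs_fps c"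
proof -
  have half: "summable (\<lambda>k. c k * (1/2) ^ k)"
    by (rule sums_summable[OF sums]) (simp add: norm_divide)
  have "conv_radius c \<ge> norm (1/2 :: complex)"
    by (rule conv_radius_geI[OF half])
  hence "fps_conv_radius (Abs_fps c) > 0"
    unfolding fps_conv_radius_def by (simp add: norm_divide less_le_trans[rotated])
  moreover have "eventually (\<lambda>z. eval_fps (Abs_fps c) z = g z) (nhds 0)"
    by (rule eventually_mono[OF eventually_nhds_in_open[of "ball 0 1"]])
       (auto simp: eval_fps_def intro!: sums_unique[symmetric] sums)
  ultimately show ?thesis
    by (simp add: has_fps_expansion_def)
qed

lemma geometric_decay_if_summable_at:
  fixes c :: "nat \<Rightarrow> real"
  assumes "R > 1" and "summable (\<lambda>k. of_real (c k) * (of_real R :: complex) ^ k)"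
  obtains C where "C > 0" "\<And>k. \<bar>c k\<bar> \<le> C * (1 / R) ^ k"
proof -
  have "Bseq (\<lambda>k. of_real (c k) * (of_real R :: complex) ^ k)"
    using assms(2) summable_LIMSEQ_zero convergentI convergent_imp_Bseq by blast
  then obtain C where C: "C > 0" "\<And>k. norm (of_real (c k) * (of_real R :: complex) ^ k) \<le> C"
    by (auto simp: Bseq_def)
  have "\<bar>c k\<bar> \<le> C * (1 / R) ^ k" for k
    using C(2)[of k] assms(1) by (simp add: norm_mult norm_power power_divide field_simps)
  with C(1) show ?thesis using that by blast
qed

text \<open>
  The Taylor series of a holomorphic function converges on every disc where the function is
  holomorphic, so the given series also converges at a point \<open>T > 1\<close>; its terms are bounded
  there, which is geometric decay of the coefficients.
\<close>
lemma holomorphic_larger_disc_coeffs: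
  fixes c :: "nat \<Rightarrow> real"
  assumes "R > 1" and holo: "g holomorphic_on ball 0 R"
    and sums: "\<And>z::complex. norm z < 1 \<Longrightarrow> (\<lambda>k. of_real (c k) * z ^ k) sums g z"
  obtains C \<rho> where "C > 0" "0 < \<rho>" "\<rho> < 1" "\<And>k. \<bar>c k\<bar> \<le> C * \<rho> ^ k"
    "(\<lambda>k. of_real (c k)) sums g 1"
proof -
  have exp: "g has_fps_expansion Abs_fps (\<lambda>k. of_real (c k))"
    using sums by (rule has_fps_expansion_if_sums_unit_disc)
  have ext: "(\<lambda>k. of_real (c k) * z ^ k) sums g z" if "norm z < R" for z :: complex
    using has_fps_expansion_imp_sums_complex[OF exp, of "ereal R" z] holo that by simp
  define T where "T = (1 + R) / 2"
  have T: "1 < T" "T < R"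
    using assms(1) by (auto simp: T_def)
  have "summable (\<lambda>k. of_real (c k) * (of_real T :: complex) ^ k)"
    using ext[of "of_real T"] T by (auto simp: sums_iff)
  then obtain C where C: "C > 0" "\<And>k. \<bar>c k\<bar> \<le> C * (1 / T) ^ k"
    using geometric_decay_if_summable_at T(1) by blast
  moreover have "(\<lambda>k. of_real (c k)) sums g 1"
    using ext[of 1] assms(1) by simp
  ultimately show ?thesis
    using that[of C "1 / T"] T(1) by simp
qed

text \<open>A polynomial has only finitely many zeros, so one of them is closest to the origin.\<close>
lemma lag_poly_nonzero_larger_disc:
  assumes "b 0 \<noteq> 0" and nz: "\<And>z::complex. norm z \<le> 1 \<Longrightarrow> lag_poly b q z \<noteq> 0"
  obtains R where "R > 1" "\<And>z::complex. norm z < R \<Longrightarrow> lag_poly b q z \<noteq> 0"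
proof -
  define Z where "Z = {z::complex. lag_poly b q z = 0}"
  have "finite Z"
    unfolding Z_def lag_poly_def using assms(1) by (subst polyfun_finite_roots) (auto intro!: exI[of _ 0])
  \<comment> \<open>The value 2 covers the case of no zeros; any number above 1 would do.\<close>
  define R where "R = Min (insert 2 (norm ` Z))"
  have "R > 1"
    unfolding R_def using \<open>finite Z\<close> nz by (subst Min_gr_iff) (auto simp: Z_def not_le[symmetric])
  moreover have "lag_poly b q z \<noteq> 0" if "norm z < R" for z :: complex
    using that \<open>finite Z\<close> by (auto simp: R_def Z_def)
  ultimately show ?thesis using that by blast
qed

lemma holomorphic_lag_poly [holomorphic_intros]: "lag_poly c n holomorphic_on A"
  unfolding lag_poly_def by (intro holomorphic_intros)

lemma lag_poly_of_real: "lag_poly c n (of_real x) = (of_real (lag_poly c n x) :: complex)"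
  by (simp add: lag_poly_def)

section \<open>Convolution with a sequence whose successive quotients tend to 1\<close>

lemma shifted_quotient_tendsto_1:
  fixes c :: "nat \<Rightarrow> real"
  assumes nz: "\<And>n. c n \<noteq> 0" and lim: "(\<lambda>n. c (Suc n) / c n) \<longlonglongrightarrow> 1"
  shows "(\<lambda>n. c n / c (n + k)) \<longlonglongrightarrow> 1"
proof (induction k)
  case 0
  show ?case using nz by simp
next
  case (Suc k)
  have "(\<lambda>n. c (Suc (n + k)) / c (n + k)) \<longlonglongrightarrow> 1"
    using LIMSEQ_ignore_initial_segment[OF lim, of k] by simp
  from tendsto_divide[OF Suc this] show ?case
    using nz by simp
qed

text \<open>
  This bound is the domination needed to interchange limit and sum below. The sequence
  \<open>\<bar>c\<^sub>n\<bar> \<mu>\<^sup>n\<close> is increasing from some index \<open>N\<close> on, and the finitely many earlier terms are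
  positive, so each term is at most a fixed multiple of every later one.
\<close>
lemma earlier_terms_geometric_bound:
  fixes c :: "nat \<Rightarrow> real"
  assumes nz: "\<And>n. c n \<noteq> 0" and lim: "(\<lambda>n. c (Suc n) / c n) \<longlonglongrightarrow> 1" and "\<mu> > 1"
  obtains D where "D > 0" "\<And>n k. \<bar>c n / c (n + k)\<bar> \<le> D * \<mu> ^ k"
proof -
  define g where "g n = \<bar>c n\<bar> * \<mu> ^ n" for n
  have g_pos: "g n > 0" for n
    using nz \<open>\<mu> > 1\<close> by (simp add: g_def)
  have "(\<lambda>n. \<bar>c (Suc n) / c n\<bar>) \<longlonglongrightarrow> 1"
    using tendsto_rabs[OF lim] by simp
  moreover have "1 / \<mu> < 1" using \<open>\<mu> > 1\<close> by simp
  ultimately have "eventually (\<lambda>n. \<bar>c (Suc n) / c n\<bar> > 1 / \<mu>) sequentially"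
    by (rule order_tendstoD)
  then obtain N where N: "\<And>n. n \<ge> N \<Longrightarrow> \<bar>c (Suc n) / c n\<bar> > 1 / \<mu>"
    by (auto simp: eventually_sequentially)
  have step: "g n \<le> g (Suc n)" if "n \<ge> N" for n
  proof -
    have "\<bar>c n\<bar> \<le> \<bar>c (Suc n)\<bar> * \<mu>"
      using N[OF that] nz[of n] \<open>\<mu> > 1\<close> by (simp add: field_simps)
    hence "\<bar>c n\<bar> * \<mu> ^ n \<le> \<bar>c (Suc n)\<bar> * \<mu> * \<mu> ^ n"
      using \<open>\<mu> > 1\<close> by (intro mult_right_mono) auto
    thus ?thesis by (simp add: g_def mult_ac)
  qed
  have mono: "g m \<le> g n" if "N \<le> m" "m \<le> n" for m n
    using that(2,1) by (induction rule: dec_induct) (auto intro: order.trans step)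
  define M where "M = Max (g ` {..N})"
  define m where "m = Min (g ` {..N})"
  have M: "g n \<le> M" if "n \<le> N" for n
    using that by (auto simp: M_def)
  have m: "m \<le> g n" for n
  proof (cases "n \<le> N")
    case True
    thus ?thesis by (auto simp: m_def)
  next
    case False
    hence "m \<le> g N" "g N \<le> g n" using mono[of N n] by (auto simp: m_def)
    thus ?thesis by simp
  qed
  have "m > 0" unfolding m_def by (subst Min_gr_iff) (auto simp: g_pos)
  have "m \<le> M" using m[of 0] M[of 0] by simp
  have bound: "g n \<le> M / m * g (n + k)" for n k
  proof (cases "n \<le> N")
    case True
    hence "g n \<le> M / m * m" using M \<open>m > 0\<close> by simp
    also have "\<dots> \<le> M / m * g (n + k)"
      using m \<open>m > 0\<close> \<open>m \<le> M\<close> by (intro mult_left_mono) auto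
    finally show ?thesis .
  next
    case False
    hence "g n \<le> 1 * g (n + k)" using mono[of n "n + k"] by simp
    also have "\<dots> \<le> M / m * g (n + k)"
      using g_pos[of "n + k"] \<open>m > 0\<close> \<open>m \<le> M\<close> by (intro mult_right_mono) auto
    finally show ?thesis .
  qed
  have "\<bar>c n / c (n + k)\<bar> \<le> M / m * \<mu> ^ k" for n k
  proof -
    have "\<bar>c n\<bar> * \<mu> ^ n \<le> (M / m * \<mu> ^ k * \<bar>c (n + k)\<bar>) * \<mu> ^ n"
      using bound[of n k] by (simp add: g_def power_add mult_ac)
    hence "\<bar>c n\<bar> \<le> M / m * \<mu> ^ k * \<bar>c (n + k)\<bar>"
      using \<open>\<mu> > 1\<close> by (subst (asm) mult_le_cancel_right_pos) auto
    thus ?thesis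
      using nz[of "n + k"] by (simp add: pos_divide_le_eq)
  qed
  moreover have "M / m > 0" using \<open>m > 0\<close> \<open>m \<le> M\<close> by simp
  ultimately show ?thesis using that by blast
qed

text \<open>
  Dominated convergence (Tannery's theorem) for \<open>\<Sum>\<^sub>k (c\<^sub>n\<^sub>-\<^sub>k / c\<^sub>n) F\<^sub>k\<close>: the quotients tend to
  1, and the summands are at most a constant times \<open>(\<mu>\<rho>)\<^sup>k\<close>.
\<close>
lemma convolution_quotient_tendsto:
  fixes c F :: "nat \<Rightarrow> real"
  assumes nz: "\<And>n. c n \<noteq> 0" and lim: "(\<lambda>n. c (Suc n) / c n) \<longlonglongrightarrow> 1"
    and "0 < \<rho>" "\<rho> < 1" and F: "\<And>n. \<bar>F n\<bar> \<le> C * \<rho> ^ n"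
  shows "(\<lambda>n. (\<Sum>k\<le>n. c (n - k) * F k) / c n) \<longlonglongrightarrow> suminf F"
proof -
  \<comment> \<open>The growth rate \<open>\<mu>\<close> allowed to the quotients must leave \<open>\<mu> \<rho> < 1\<close>.\<close>
  have "1 < 1 / \<rho>" using \<open>0 < \<rho>\<close> \<open>\<rho> < 1\<close> by simp
  then obtain \<mu> where \<mu>: "1 < \<mu>" "\<mu> < 1 / \<rho>" using dense by blast
  obtain D where D: "D > 0" "\<And>n k. \<bar>c n / c (n + k)\<bar> \<le> D * \<mu> ^ k"
    using earlier_terms_geometric_bound[OF nz lim \<mu>(1)] by blast
  define t where "t k n = (if k \<le> n then c (n - k) / c n * F k else 0)" for k n
  have t_lim: "(\<lambda>n. t k n) \<longlonglongrightarrow> F k" for k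
  proof -
    have "(\<lambda>n. c n / c (n + k) * F k) \<longlonglongrightarrow> 1 * F k"
      by (intro tendsto_intros shifted_quotient_tendsto_1[OF nz lim])
    hence "(\<lambda>n. t k (n + k)) \<longlonglongrightarrow> F k" by (simp add: t_def)
    thus ?thesis by (rule LIMSEQ_offset)
  qed
  have t_bound: "norm (t k n) \<le> D * C * (\<mu> * \<rho>) ^ k" for k n
  proof (cases "k \<le> n")
    case True
    have "norm (t k n) = \<bar>c (n - k) / c (n - k + k)\<bar> * \<bar>F k\<bar>"
      using True by (simp add: t_def abs_mult)
    also have "\<dots> \<le> (D * \<mu> ^ k) * (C * \<rho> ^ k)"
      using D \<mu>(1) F by (intro mult_mono) auto
    finally show ?thesis by (simp add: power_mult_distrib mult_ac)
  next
    case False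
    have "0 \<le> C" using F[of 0] by simp
    thus ?thesis using False D(1) \<mu>(1) \<open>0 < \<rho>\<close> by (simp add: t_def)
  qed
  have M_summable: "summable (\<lambda>k. D * C * (\<mu> * \<rho>) ^ k)"
    using \<mu> \<open>0 < \<rho>\<close> by (intro summable_mult summable_geometric) (simp add: field_simps)
  have dominated: "eventually (\<lambda>(k, n). norm (t k n) \<le> D * C * (\<mu> * \<rho>) ^ k)
      (sequentially \<times>\<^sub>F sequentially)"
    using t_bound by (intro always_eventually) auto
  have "(\<lambda>n. suminf (\<lambda>k. t k n)) \<longlonglongrightarrow> suminf F"
    using tannerys_theorem[OF t_lim dominated M_summable] by simp
  moreover have "suminf (\<lambda>k. t k n) = (\<Sum>k\<le>n. c (n - k) * F k) / c n" for n
  proof -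
    have "suminf (\<lambda>k. t k n) = (\<Sum>k\<le>n. t k n)"
      by (intro suminf_finite) (auto simp: t_def)
    thus ?thesis by (simp add: t_def sum_divide_distrib)
  qed
  ultimately show ?thesis by simp
qed

section \<open>Fractional coefficients and the convolution formula\<close>

lemma pochhammer_quotient_ratio_tendsto:
  fixes d :: real
  assumes "d \<notin> \<int>\<^sub>\<le>\<^sub>0"
  shows "(\<lambda>k. (pochhammer d (Suc k) / fact (Suc k)) / (pochhammer d k / fact k)) \<longlonglongrightarrow> 1"
proof -
  have "pochhammer d k \<noteq> 0" for k
    using assms pochhammer_eq_0_imp_nonpos_Int by blast
  hence "(\<lambda>k. (pochhammer d (Suc k) / fact (Suc k)) / (pochhammer d k / fact k))
      = (\<lambda>k. (d + real k) / (real k + 1))"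
    by (intro ext) (simp add: pochhammer_Suc add_ac)
  moreover have "(\<lambda>k. (d + real k) / (real k + 1)) \<longlonglongrightarrow> 1"
    by real_asymp
  ultimately show ?thesis by simp
qed

lemma sfrac_coeff_mult:
  "s \<ge> 1 \<Longrightarrow> sfrac_coeff d s (s * k) = pochhammer d k / fact k"
  by (simp add: sfrac_coeff_def)

text \<open>
  The Cauchy product of the two series at index \<open>sk+r\<close>. The factor \<open>\<pi>\<close> vanishes off the
  multiples of \<open>s\<close>, which leaves only the coefficients of \<open>g\<close> in the residue class of \<open>r\<close>.
\<close>
lemma lam_convolution:
  fixes d :: real and lam f :: "nat \<Rightarrow> real" and g :: "complex \<Rightarrow> complex"
  assumes "s \<ge> 1"
    and f: "\<And>z::complex. norm z < 1 \<Longrightarrow> (\<lambda>k. of_real (f k) * z ^ k) sums g z"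
    and lam: "\<And>z::complex. norm z < 1 \<Longrightarrow>
           (\<lambda>k. of_real (lam k) * z ^ k) sums (g z * (1 - z ^ s) powr of_real (- d))"
    and "r < s"
  shows "lam (s * k + r) = (\<Sum>j\<le>k. sfrac_coeff d s (s * (k - j)) * f (s * j + r))"
proof -
  let ?n = "s * k + r"
  have "Abs_fps (\<lambda>k. of_real (lam k) :: complex) =
        Abs_fps (\<lambda>k. of_real (f k)) * Abs_fps (\<lambda>k. of_real (sfrac_coeff d s k))"
    by (rule fps_expansion_unique_complex[where f = "\<lambda>z. g z * (1 - z ^ s) powr of_real (- d)"])
       (intro has_fps_expansion_mult has_fps_expansion_if_sums_unit_disc f lam
              sfrac_coeff_sums assms(1) | assumption)+
  from arg_cong[OF this, of "\<lambda>F. fps_nth F ?n"]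
  have "(of_real (lam ?n) :: complex) = of_real (\<Sum>i=0..?n. f i * sfrac_coeff d s (?n - i))"
    by (simp add: fps_mult_nth)
  hence "lam ?n = (\<Sum>i=0..?n. f i * sfrac_coeff d s (?n - i))"
    by (simp only: of_real_eq_iff)
  also have "\<dots> = (\<Sum>i\<in>(\<lambda>j. s * j + r) ` {..k}. f i * sfrac_coeff d s (?n - i))"
  proof (intro sum.mono_neutral_right ballI)
    show "(\<lambda>j. s * j + r) ` {..k} \<subseteq> {0..?n}" by auto
  next
    fix i assume i: "i \<in> {0..?n} - (\<lambda>j. s * j + r) ` {..k}"
    have "\<not> s dvd ?n - i"
    proof
      assume "s dvd ?n - i"
      then obtain l where l: "?n = i + s * l" using i by (auto simp: dvd_def) (metis le_add_diff_inverse)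
      have "l \<le> k"
      proof (rule ccontr)
        assume "\<not> l \<le> k"
        hence "s * l \<ge> s * (k + 1)" by (intro mult_le_mono) auto
        thus False using l \<open>r < s\<close> by simp
      qed
      hence "i = s * (k - l) + r" using l by (simp add: diff_mult_distrib2)
      thus False using i by auto
    qed
    thus "f i * sfrac_coeff d s (?n - i) = 0" by (simp add: sfrac_coeff_def)
  qed auto
  also have "\<dots> = (\<Sum>j\<le>k. f (s * j + r) * sfrac_coeff d s (?n - (s * j + r)))"
    using assms(1) by (subst sum.reindex) (auto simp: inj_on_def)
  also have "\<dots> = (\<Sum>j\<le>k. sfrac_coeff d s (s * (k - j)) * f (s * j + r))"
    by (simp add: diff_mult_distrib2 mult_ac)
  finally show ?thesis .
qed

section \<open>Asymptotics of the seasonal coefficients\<close>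

lemma geometric_decay_smallo_powr:
  fixes x :: "nat \<Rightarrow> real"
  assumes "0 < \<rho>" "\<rho> < 1" and x: "\<And>n. \<bar>x n\<bar> \<le> C * \<rho> ^ n" and "s \<ge> 1"
  shows "(\<lambda>k. x (s * k + r)) \<in> o(\<lambda>k. real k powr (- \<nu>))"
proof -
  have "C \<ge> 0" using x[of 0] by simp
  have "\<bar>x (s * k + r)\<bar> \<le> C * \<rho> ^ k" for k
  proof -
    have "k \<le> s * k + r" using \<open>s \<ge> 1\<close> by (simp add: trans_le_add1)
    hence "\<rho> ^ (s * k + r) \<le> \<rho> ^ k"
      using assms(1,2) by (intro power_decreasing) auto
    with x[of "s * k + r"] \<open>C \<ge> 0\<close> show ?thesis
      by (meson mult_left_mono order.trans)
  qed
  hence "(\<lambda>k. x (s * k + r)) \<in> O(\<lambda>k. \<rho> ^ k)"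
    using assms(1) by (intro bigoI[of _ C]) auto
  also have "(\<lambda>k. \<rho> ^ k) \<in> o(\<lambda>k. real k powr (- \<nu>))"
    using assms(1,2) by real_asymp
  finally show ?thesis .
qed

theorem theorem1p1:
  fixes d :: real and s p q :: nat
    and a b :: "nat \<Rightarrow> real"
    and lam f :: "nat \<Rightarrow> real"
  assumes "s \<ge> 1"
    and "a 0 = - 1" and "b 0 = - 1"
    and "a p \<noteq> 0" and "b q \<noteq> 0"
    and "\<not> (\<exists>z::complex. lag_poly a p z = 0 \<and> lag_poly b q z = 0)"
    and "\<And>z::complex. norm z \<le> 1 \<Longrightarrow> lag_poly b q z \<noteq> 0"
    and "\<And>z::complex. norm z < 1 \<Longrightarrow>
           (\<lambda>k. of_real (f k) * z ^ k) sums (lag_poly a p z / lag_poly b q z)"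
    and "\<And>z::complex. norm z < 1 \<Longrightarrow>
           (\<lambda>k. of_real (lam k) * z ^ k) sums
             (lag_poly a p z / lag_poly b q z * (1 - z ^ s) powr of_real (- d))"
  shows "(\<exists>K :: nat \<Rightarrow> real.
            (\<forall>r\<in>{0..s - 1}. \<forall>\<nu>>0::real.
               (\<lambda>k. lam (s * k + r) - sfrac_coeff d s (s * k) * K (s * k + r))
                 \<in> o(\<lambda>k. real k powr (- \<nu>))) \<and>
            (\<lambda>k. \<Sum>r=0..s - 1. K (s * k + r)) \<longlonglongrightarrow> lag_poly a p 1 / lag_poly b q 1) \<and>
         (d \<notin> \<int>\<^sub>\<le>\<^sub>0 \<and> lag_poly a p (1::real) \<noteq> 0 \<longrightarrow>
            (\<lambda>k. \<Sum>r=0..s - 1. lam (s * k + r)) \<sim>[sequentially]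
              (\<lambda>k. sfrac_coeff d s (s * k) * (lag_poly a p 1 / lag_poly b q 1)))"
proof -
  define \<Lambda> where "\<Lambda> = lag_poly a p (1::real) / lag_poly b q 1"
  define g where "g z = lag_poly a p z / lag_poly b q z" for z :: complex
  obtain R where R: "R > 1" "\<And>z::complex. norm z < R \<Longrightarrow> lag_poly b q z \<noteq> 0"
    using lag_poly_nonzero_larger_disc[of b q] assms(3,7) by auto
  have g_holo: "g holomorphic_on ball 0 R"
    unfolding g_def using R(2) by (intro holomorphic_intros) auto
  have g1: "g 1 = of_real \<Lambda>"
    using lag_poly_of_real[of a p 1] lag_poly_of_real[of b q 1] by (simp add: g_def \<Lambda>_def)
  have f_sums: "(\<lambda>k. of_real (f k) * z ^ k) sums g z" if "norm z < 1" for z :: complex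
    using assms(8)[OF that] by (simp add: g_def)
  have lam_sums: "(\<lambda>k. of_real (lam k) * z ^ k) sums (g z * (1 - z ^ s) powr of_real (- d))"
    if "norm z < 1" for z :: complex
    using assms(9)[OF that] by (simp add: g_def)
  have range_eq: "{0..s - 1} = {..<s}" using assms(1) by auto
  show ?thesis
  proof (cases "d \<in> \<int>\<^sub>\<le>\<^sub>0")
    case True
    then obtain m where m: "d = - real m" by (auto elim: nonpos_Ints_cases')
    define h where "h z = g z * (1 - z ^ s) ^ m" for z :: complex
    have h_sums: "(\<lambda>k. of_real (lam k) * z ^ k) sums h z" if "norm z < 1" for z :: complex
    proof -
      have "norm (z ^ s) < 1" using that assms(1) by (simp add: norm_power power_less_one_iff)
      hence "1 - z ^ s \<noteq> 0" by auto
      hence "(1 - z ^ s) powr of_real (- d) = (1 - z ^ s) ^ m"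
        by (simp add: m powr_nat')
      with lam_sums[OF that] show ?thesis by (simp add: h_def)
    qed
    have "h holomorphic_on ball 0 R"
      unfolding h_def by (intro holomorphic_intros g_holo)
    then obtain C \<rho> where lam_decay: "0 < \<rho>" "\<rho> < 1" "\<And>n. \<bar>lam n\<bar> \<le> C * \<rho> ^ n"
      using holomorphic_larger_disc_coeffs[OF R(1) _ h_sums] by metis
    \<comment> \<open>Exactly one index of each block of length \<open>s\<close> is a multiple of \<open>s\<close>.\<close>
    define K where "K n = (if s dvd n then \<Lambda> else 0)" for n
    have "(\<lambda>k. lam (s * k + r) - sfrac_coeff d s (s * k) * K (s * k + r))
        \<in> o(\<lambda>k. real k powr (- \<nu>))" for r and \<nu> :: real
    proof -
      have "eventually (\<lambda>k. sfrac_coeff d s (s * k) = 0) sequentially"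
        using eventually_gt_at_top[of m]
        by eventually_elim (use assms(1) in \<open>simp add: sfrac_coeff_mult m pochhammer_of_nat_eq_0_lemma\<close>)
      hence "eventually (\<lambda>k. lam (s * k + r) - sfrac_coeff d s (s * k) * K (s * k + r)
               = lam (s * k + r)) sequentially"
        by eventually_elim simp
      with geometric_decay_smallo_powr[OF lam_decay assms(1), of r \<nu>] show ?thesis
        by (subst landau_o.small.in_cong)
    qed
    moreover have "(\<Sum>r=0..s - 1. K (s * k + r)) = \<Lambda>" for k
    proof -
      have "(\<Sum>r<s. K (s * k + r)) = (\<Sum>r<s. if r = 0 then \<Lambda> else 0)"
        by (intro sum.cong) (auto simp: K_def dvd_add_right_iff dest: dvd_imp_le)
      thus ?thesis using assms(1) unfolding range_eq by simp
    qed
    ultimately show ?thesis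
      using True by (intro conjI exI[of _ K]) (auto simp: \<Lambda>_def)
  next
    case False
    obtain C \<rho> where f_decay: "C > 0" "0 < \<rho>" "\<rho> < 1" "\<And>n. \<bar>f n\<bar> \<le> C * \<rho> ^ n"
      and "(\<lambda>k. of_real (f k)) sums g 1"
      using holomorphic_larger_disc_coeffs[OF R(1) g_holo f_sums] by metis
    hence f_total: "f sums \<Lambda>"
      by (simp add: g1 sums_of_real_iff)
    define F where "F j = (\<Sum>r<s. f (s * j + r))" for j
    define c where "c k = sfrac_coeff d s (s * k)" for k
    have c_eq: "c k = pochhammer d k / fact k" for k
      using assms(1) by (simp add: c_def sfrac_coeff_mult)
    have c_nz: "c k \<noteq> 0" for k
      using False pochhammer_eq_0_imp_nonpos_Int by (auto simp: c_eq)
    have c_ratio: "(\<lambda>k. c (Suc k) / c k) \<longlonglongrightarrow> 1"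
      unfolding c_eq using False by (rule pochhammer_quotient_ratio_tendsto)
    have F_decay: "\<bar>F j\<bar> \<le> (real s * C) * \<rho> ^ j" for j
    proof -
      have "\<bar>F j\<bar> \<le> (\<Sum>r<s. \<bar>f (s * j + r)\<bar>)"
        unfolding F_def by (rule sum_abs)
      also have "\<dots> \<le> (\<Sum>r<s. C * \<rho> ^ j)"
      proof (rule sum_mono)
        fix r
        have "j \<le> s * j + r" using assms(1) by (simp add: trans_le_add1)
        hence "\<rho> ^ (s * j + r) \<le> \<rho> ^ j"
          using f_decay by (intro power_decreasing) auto
        with f_decay(4)[of "s * j + r"] f_decay(1) show "\<bar>f (s * j + r)\<bar> \<le> C * \<rho> ^ j"
          by (meson less_imp_le mult_left_mono order.trans)
      qed
      finally show ?thesis by simp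
    qed
    have "F sums \<Lambda>"
    proof -
      have "sum f {j * s..<j * s + s} = F j" for j
        unfolding F_def
        by (rule sum.reindex_bij_witness[of _ "\<lambda>r. s * j + r" "\<lambda>i. i - s * j"])
           (auto simp: mult.commute)
      with sums_group[OF f_total, of s] assms(1) show ?thesis by simp
    qed
    have block: "(\<Sum>r<s. lam (s * k + r)) = (\<Sum>j\<le>k. c (k - j) * F j)" for k
    proof -
      have "(\<Sum>r<s. lam (s * k + r)) = (\<Sum>r<s. \<Sum>j\<le>k. c (k - j) * f (s * j + r))"
        unfolding c_def
        by (intro sum.cong refl lam_convolution[OF assms(1) f_sums lam_sums]) auto
      also have "\<dots> = (\<Sum>j\<le>k. \<Sum>r<s. c (k - j) * f (s * j + r))"
        by (rule sum.swap)
      finally show ?thesis by (simp add: F_def sum_distrib_left)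
    qed
    have main: "(\<lambda>k. (\<Sum>r<s. lam (s * k + r)) / c k) \<longlonglongrightarrow> \<Lambda>"
      using convolution_quotient_tendsto[OF c_nz c_ratio f_decay(2,3) F_decay]
        sums_unique[OF \<open>F sums \<Lambda>\<close>] by (simp add: block)
    define K where "K n = lam n / c (n div s)" for n
    have K_eq: "K (s * k + r) = lam (s * k + r) / c k" if "r < s" for k r
      using that by (simp add: K_def)
    have "(\<lambda>k. lam (s * k + r) - sfrac_coeff d s (s * k) * K (s * k + r))
        \<in> o(\<lambda>k. real k powr (- \<nu>))" if "r \<in> {0..s - 1}" for r and \<nu> :: real
      using c_nz that unfolding range_eq by (simp add: K_eq flip: c_def)
    moreover have "(\<lambda>k. \<Sum>r=0..s - 1. K (s * k + r)) \<longlonglongrightarrow> \<Lambda>"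
      unfolding range_eq using main by (simp add: K_eq sum_divide_distrib)
    moreover have "(\<lambda>k. \<Sum>r=0..s - 1. lam (s * k + r)) \<sim>[sequentially]
        (\<lambda>k. sfrac_coeff d s (s * k) * \<Lambda>)" if "lag_poly a p (1::real) \<noteq> 0"
    proof -
      have "lag_poly b q (1::real) \<noteq> 0"
        using assms(7)[of 1] lag_poly_of_real[of b q 1] by auto
      hence "\<Lambda> \<noteq> 0" using that by (simp add: \<Lambda>_def)
      have "(\<lambda>k. (\<Sum>r<s. lam (s * k + r)) / c k / \<Lambda>) \<longlonglongrightarrow> \<Lambda> / \<Lambda>"
        using \<open>\<Lambda> \<noteq> 0\<close> by (intro tendsto_divide main tendsto_const)
      thus ?thesis
        using \<open>\<Lambda> \<noteq> 0\<close> unfolding range_eq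
        by (intro asymp_equivI') (simp flip: c_def)
    qed
    ultimately show ?thesis
      unfolding \<Lambda>_def[symmetric] by (intro conjI exI[of _ K] ballI allI impI) auto
  qed
qed

end
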